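(* Let $\mathbf F(t)\in\mathbb R^3[t]$ be a truly spatial polynomial field of degree $n$ without non-constant real polynomial factors, let $\beta\in\mathbb C$, and write $\mathbf F(t)=\sum_{j=0}^n\mathbf f_j(t-\beta)^j$ with $\mathbf f_j\in\mathbb C^3$. Let $(i_1,i_2,i_3)$ be a triplet of indices in $\{0,\dots,n\}$ such that $\mathbf f_{i_1},\mathbf f_{i_2},\mathbf f_{i_3}$ are linearly independent over $\mathbb C$. Put $D=\{-1-i_1,-1-i_2,-1-i_3\}$ and $I=\{-1,-2,\dots,-n-1\}\setminus D$, so that $I$ has $n-2$ elements. For each $k\in I$ set $\lambda_k=1$ and $\lambda_l=0$ for $l\in I\setminus\{k\}$; then the equation $$\lambda_{-1}\mathbf f_0+\lambda_{-2}\mathbf f_1+\cdots+\lambda_{-n-1}\mathbf f_n=0$$ determines the remaining values $\lambda_l$, $l\in D$, uniquely. Let $\mathbf r^{(k)}(t)=\sum_{j=-n}^{n}\mathbf r_j(t-\beta)^j$ be the curve with coefficients $\mathbf r_0=\mathbf 0$ and $$\mathbf r_j=\frac1j\sum_{\substack{-n-1\le a\le -1,\ 0\le b\le n\\ a+b=j-1}}\lambda_a\mathbf f_b\qquad(j\ne 0).$$ Then the $n-2$ curves $\mathbf r^{(k)}(t)$, $k\in I$, form a basis of the complex vector space $\mathcal N^\beta$.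
   Context: Setting. $\mathbf F(t)\in\mathbb R^3[t]$ is a polynomial vector field of degree $n$ (the maximal degree of its components); its three components have no non-constant common factor in $\mathbb R[t]$; and it is truly spatial, i.e. its coefficient vectors span $\mathbb R^3$. Normalized integral. If $\mathbf g(t)=\sum_j\mathbf g_j(t-\beta)^j$ is a finite sum ($j\in\mathbb Z$, $\mathbf g_j\in\mathbb C^3$) with zero residue $\mathbf g_{-1}=0$, then its normalized antiderivative at $\beta$ is $\sum_{j\ne -1}\frac{1}{j+1}\mathbf g_j(t-\beta)^{j+1}$, which has zero coefficient at $(t-\beta)^0$. Non-regular curves. $\mathcal N^\beta$ is the complex vector space of normalized antiderivatives at $\beta$ of $\lambda(t)\mathbf F(t)$, where $\lambda(t)=\sum_{j=-n-1}^{-1}\lambda_j(t-\beta)^j$ and $\lambda_{-n-1},\dots,\lambda_{-1}\in\mathbb C$ satisfy the zero-residue condition $\lambda_{-1}\mathbf f_0+\lambda_{-2}\mathbf f_1+\cdots+\lambda_{-n-1}\mathbf f_n=0$. *)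

theory Defs
  imports "HOL-Analysis.Analysis" "HOL-Computational_Algebra.Computational_Algebra"
begin

section \<open>Polynomial vector fields\<close>

definition field_degree :: "real poly ^ 3 \<Rightarrow> nat" where
  "field_degree F = Max (range (\<lambda>i. degree (F $ i)))"

definition no_common_factor :: "real poly ^ 3 \<Rightarrow> bool" where
  "no_common_factor F \<longleftrightarrow> (\<forall>d. (\<forall>i. d dvd F $ i) \<longrightarrow> degree d = 0)"

definition truly_spatial :: "real poly ^ 3 \<Rightarrow> bool" where
  "truly_spatial F \<longleftrightarrow> span {v. \<exists>j. v = (\<chi> i. coeff (F $ i) j)} = (UNIV :: (real ^ 3) set)"

text \<open>The components of \<open>F(s + \<beta>)\<close> as polynomials in \<open>s = t - \<beta>\<close>.\<close>

definition shifted_field :: "real poly ^ 3 \<Rightarrow> complex \<Rightarrow> complex poly ^ 3" where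
  "shifted_field F \<beta> = (\<chi> i. pcompose (map_poly complex_of_real (F $ i)) [:\<beta>, 1:])"

definition field_coeff :: "real poly ^ 3 \<Rightarrow> complex \<Rightarrow> nat \<Rightarrow> complex ^ 3" where
  "field_coeff F \<beta> j = (\<chi> i. coeff (shifted_field F \<beta> $ i) j)"

lemma degree_shifted_field: "degree (shifted_field F \<beta> $ i) \<le> field_degree F"
proof -
  have "degree (shifted_field F \<beta> $ i) = degree (F $ i)"
    by (simp add: shifted_field_def degree_pcompose degree_map_poly)
  also have "\<dots> \<le> field_degree F"
    unfolding field_degree_def by (rule Max_ge) auto
  finally show ?thesis .
qed

lemma field_expansion:
  "map_poly complex_of_real (F $ i) =
     (\<Sum>j\<le>field_degree F. smult (field_coeff F \<beta> j $ i) ([:-\<beta>, 1:] ^ j))"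
proof -
  let ?p = "map_poly complex_of_real (F $ i)" and ?q = "shifted_field F \<beta> $ i"
  have "?p = pcompose ?q [:-\<beta>, 1:]"
    by (simp add: shifted_field_def pcompose_assoc [symmetric] pcompose_pCons)
  also have "\<dots> = pcompose (\<Sum>j\<le>field_degree F. monom (coeff ?q j) j) [:-\<beta>, 1:]"
    by (simp add: poly_as_sum_of_monoms' degree_shifted_field)
  also have "\<dots> = (\<Sum>j\<le>field_degree F. smult (coeff ?q j) ([:-\<beta>, 1:] ^ j))"
  proof -
    have m: "pcompose (monom c j) p = smult c (p ^ j)" for c :: complex and j p
      by (induction j) (simp_all add: monom_0 monom_Suc pcompose_pCons mult_ac)
    show ?thesis by (simp add: pcompose_sum m)
  qed
  finally show ?thesis by (simp add: field_coeff_def)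
qed


section \<open>Curves as Laurent expansions at the point \<open>\<beta>\<close>\<close>

text \<open>
  A finite sum \<open>\<Sum>j. g\<^sub>j (t - \<beta>)\<^sup>j\<close> is represented by its Laurent expansion in the local
  parameter \<open>t - \<beta>\<close>, i.e. \<open>fls_X\<close> stands for \<open>t - \<beta>\<close>.
\<close>

definition laurent_sum :: "int set \<Rightarrow> (int \<Rightarrow> complex) \<Rightarrow> complex fls" where
  "laurent_sum J c = (\<Sum>j\<in>J. fls_const (c j) * fls_X_intpow j)"

definition laurent_curve :: "int set \<Rightarrow> (int \<Rightarrow> complex ^ 3) \<Rightarrow> complex fls ^ 3" where
  "laurent_curve J r = (\<chi> i. laurent_sum J (\<lambda>j. r j $ i))"

definition curve_scale :: "complex \<Rightarrow> complex fls ^ 3 \<Rightarrow> complex fls ^ 3" where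
  "curve_scale c r = fls_const c *s r"

global_interpretation curve: vector_space curve_scale
  by unfold_locales
     (simp_all add: curve_scale_def vec_eq_iff algebra_simps
        flip: fls_const_mult_const fls_plus_const)

definition field_at :: "real poly ^ 3 \<Rightarrow> complex \<Rightarrow> complex fls ^ 3" where
  "field_at F \<beta> = (\<chi> i. fps_to_fls (fps_of_poly (shifted_field F \<beta> $ i)))"

text \<open>
  \<open>fls_integral\<close> ignores the coefficient of \<open>(t - \<beta>)\<^sup>-\<^sup>1\<close> and has constant term \<open>0\<close>, so on
  Laurent sums with zero residue it is exactly the normalized antiderivative.
\<close>

definition normalized_antiderivative :: "complex fls ^ 3 \<Rightarrow> complex fls ^ 3" where
  "normalized_antiderivative g = (\<chi> i. fls_integral (g $ i))"

text \<open>The equation \<open>\<lambda>\<^sub>-\<^sub>1 f\<^sub>0 + \<lambda>\<^sub>-\<^sub>2 f\<^sub>1 + \<dots> + \<lambda>\<^sub>-\<^sub>n\<^sub>-\<^sub>1 f\<^sub>n = 0\<close>.\<close>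

definition zero_residue :: "nat \<Rightarrow> (nat \<Rightarrow> complex ^ 3) \<Rightarrow> (int \<Rightarrow> complex) \<Rightarrow> bool" where
  "zero_residue n f lam \<longleftrightarrow> (\<Sum>b\<le>n. lam (- 1 - int b) *s f b) = 0"

text \<open>The space \<open>\<N>\<^sup>\<beta>\<close>.\<close>

definition nonregular_curves :: "real poly ^ 3 \<Rightarrow> complex \<Rightarrow> (complex fls ^ 3) set" where
  "nonregular_curves F \<beta> = (let n = field_degree F in
     {normalized_antiderivative (laurent_sum {- int n - 1 .. - 1} lam *s field_at F \<beta>) | lam.
        zero_residue n (field_coeff F \<beta>) lam})"

definition curve_coeff ::
    "nat \<Rightarrow> (nat \<Rightarrow> complex ^ 3) \<Rightarrow> (int \<Rightarrow> complex) \<Rightarrow> int \<Rightarrow> complex ^ 3" where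
  "curve_coeff n f lam j =
     (if j = 0 then 0
      else (1 / of_int j) *s
        (\<Sum>(a, b) \<in> {(a, b). a \<in> {- int n - 1 .. - 1} \<and> b \<in> {0..n} \<and> a + int b = j - 1}.
           lam a *s f b))"

end

theory Submission
  imports Defs
begin

text \<open>
  Multiplication by \<open>\<lambda>\<close> followed by normalized integration is a linear map \<open>\<Phi>\<close>; it is injective
  on the coefficient families with zero residue, because a Laurent series with vanishing
  antiderivative and zero residue vanishes, and Laurent series form an integral domain. Hence \<open>\<N>\<^sup>\<beta>\<close>
  is isomorphic to the solution space of the residue equation, where the values on \<open>D\<close> are uniquely
  determined by the values on \<open>I\<close>.
\<close>

section \<open>Coefficients of Laurent sums and of their products with the field\<close>

notation fls_nth (infixl "$$" 75)

text \<open>The map \<Phi>. The residue condition is kept out of the definition, so \<Phi> is linear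
  on all families; \<open>fls_integral\<close> simply drops a nonzero residue.\<close>

definition multiplier_curve :: "real poly ^ 3 \<Rightarrow> complex \<Rightarrow> (int \<Rightarrow> complex) \<Rightarrow> complex fls ^ 3" where
  "multiplier_curve F \<beta> lam = normalized_antiderivative
     (laurent_sum {- int (field_degree F) - 1 .. - 1} lam *s field_at F \<beta>)"

lemma nonregular_curves_altdef:
  "nonregular_curves F \<beta> =
     {multiplier_curve F \<beta> lam | lam. zero_residue (field_degree F) (field_coeff F \<beta>) lam}"
  by (simp add: nonregular_curves_def multiplier_curve_def Let_def)

lemma laurent_sum_nth:
  assumes "finite J"
  shows "laurent_sum J c $$ m = (if m \<in> J then c m else 0)"
proof -
  have "laurent_sum J c $$ m = (\<Sum>j\<in>J. if j = m then c j else 0)"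
    unfolding laurent_sum_def by (auto simp: fls_nth_sum intro!: sum.cong)
  then show ?thesis
    using assms by simp
qed

lemma laurent_sum_mult_nth: "(laurent_sum J c * P) $$ m = (\<Sum>j\<in>J. c j * P $$ (m - j))"
  unfolding laurent_sum_def sum_distrib_right fls_nth_sum mult.assoc
  unfolding fls_X_intpow_times_conv_shift by simp

lemma field_at_nth:
  "field_at F \<beta> $ i $$ m = (if 0 \<le> m \<and> m \<le> int (field_degree F) then field_coeff F \<beta> (nat m) $ i else 0)"
proof -
  have "coeff (shifted_field F \<beta> $ i) (nat m) = 0" if "m > int (field_degree F)"
    using degree_shifted_field[of F \<beta> i] that by (intro coeff_eq_0) linarith
  then show ?thesis
    by (simp add: field_at_def field_coeff_def)
qed

text \<open>A pair is determined by its first entry, and the guard takes over the range of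
  \<open>b\<close>. The right side has the shape of a product coefficient given by
  \<open>laurent_sum_mult_nth\<close> and \<open>field_at_nth\<close>.\<close>

lemma sum_multiplier_reindex:
  fixes f :: "nat \<Rightarrow> complex ^ 3" and lam :: "int \<Rightarrow> complex"
  shows "(\<Sum>(a, b) \<in> {(a, b). a \<in> {- int n - 1 .. - 1} \<and> b \<in> {0..n} \<and> a + int b = m}. lam a *s f b) $ i =
    (\<Sum>a\<in>{- int n - 1 .. - 1}. lam a * (if 0 \<le> m - a \<and> m - a \<le> int n then f (nat (m - a)) $ i else 0))"
proof -
  let ?S = "{- int n - 1 .. - 1}"
  let ?P = "{(a, b). a \<in> ?S \<and> b \<in> {0..n} \<and> a + int b = m}"
  have "(\<Sum>(a, b)\<in>?P. lam a *s f b) $ i = (\<Sum>(a, b)\<in>?P. lam a * f b $ i)"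
    by (simp add: case_prod_unfold)
  also have "\<dots> = (\<Sum>a\<in>{a \<in> ?S. 0 \<le> m - a \<and> m - a \<le> int n}. lam a * f (nat (m - a)) $ i)"
    by (rule sum.reindex_bij_witness[of _ "\<lambda>a. (a, nat (m - a))" fst]) auto
  also have "\<dots> = (\<Sum>a\<in>?S. if 0 \<le> m - a \<and> m - a \<le> int n then lam a * f (nat (m - a)) $ i else 0)"
    by (rule sum.inter_filter) simp
  finally show ?thesis
    by (simp add: if_distrib cong: if_cong)
qed

text \<open>Indexing by the exponent \<open>a\<close> of the multiplier exhibits the sum as the
  coefficient of the product at -1 and prepares its splitting over \<open>I\<close> and
  \<open>D\<close>.\<close>

lemma zero_residue_altdef:
  "zero_residue n f lam \<longleftrightarrow> (\<Sum>a\<in>{- int n - 1 .. - 1}. lam a *s f (nat (- 1 - a))) = 0"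
proof -
  have "(\<Sum>b\<le>n. lam (- 1 - int b) *s f b) = (\<Sum>a\<in>{- int n - 1 .. - 1}. lam a *s f (nat (- 1 - a)))"
    by (rule sum.reindex_bij_witness[of _ "\<lambda>a. nat (- 1 - a)" "\<lambda>b. - 1 - int b"]) auto
  then show ?thesis
    by (simp add: zero_residue_def)
qed

text \<open>Integration moves the coefficient at \<open>m - 1\<close> to \<open>m\<close> and
  divides it by \<open>m\<close>, as \<open>curve_coeff\<close> prescribes; at \<open>m = 0\<close>
  both sides are 0 by normalization.\<close>

lemma laurent_curve_eq_multiplier_curve:
  assumes "n = field_degree F"
  shows "laurent_curve {- int n .. int n} (curve_coeff n (field_coeff F \<beta>) lam) = multiplier_curve F \<beta> lam"
proof -
  have "laurent_sum {- int n .. int n} (\<lambda>j. curve_coeff n (field_coeff F \<beta>) lam j $ i) $$ m =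
      fls_integral (laurent_sum {- int n - 1 .. - 1} lam * field_at F \<beta> $ i) $$ m" for i m
  proof (cases "m \<in> {- int n .. int n}")
    case True
    have "(laurent_sum {- int n - 1 .. - 1} lam * field_at F \<beta> $ i) $$ (m - 1) =
      (\<Sum>(a, b) \<in> {(a, b). a \<in> {- int n - 1 .. - 1} \<and> b \<in> {0..n} \<and> a + int b = m - 1}.
        lam a *s field_coeff F \<beta> b) $ i"
      by (simp only: sum_multiplier_reindex laurent_sum_mult_nth field_at_nth assms[symmetric])
    with True show ?thesis
      by (simp add: laurent_sum_nth curve_coeff_def inverse_eq_divide)
  next
    case False
    \<comment> \<open>For \<open>m < - n\<close> every \<open>m - 1 - a\<close> is negative, and for
      \<open>m > n\<close> every one exceeds \<open>n\<close>, so the field contributes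
      nothing.\<close>
    then have "(\<Sum>a\<in>{- int n - 1 .. - 1}. lam a * field_at F \<beta> $ i $$ (m - 1 - a)) = 0"
      by (intro sum.neutral) (auto simp: field_at_nth assms[symmetric])
    with False show ?thesis
      by (auto simp: laurent_sum_nth laurent_sum_mult_nth curve_coeff_def[of _ _ _ 0])
  qed
  then show ?thesis
    by (simp add: vec_eq_iff fls_eq_iff laurent_curve_def multiplier_curve_def
        normalized_antiderivative_def assms[symmetric])
qed

section \<open>Linearity and injectivity of the multiplier map\<close>

lemma multiplier_curve_sum:
  assumes "finite K"
  shows "multiplier_curve F \<beta> (\<lambda>a. \<Sum>k\<in>K. c k * lam k a) =
    (\<Sum>k\<in>K. curve_scale (c k) (multiplier_curve F \<beta> (lam k)))"
proof -
  have "(\<Sum>a\<in>A. (\<Sum>k\<in>K. c k * lam k a) * P a) = (\<Sum>k\<in>K. c k * (\<Sum>a\<in>A. lam k a * P a))"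
    for A :: "int set" and P
    by (simp add: sum_distrib_left sum_distrib_right mult.assoc sum.swap[of _ A])
  then show ?thesis
    by (auto simp: vec_eq_iff fls_eq_iff multiplier_curve_def normalized_antiderivative_def
        curve_scale_def laurent_sum_mult_nth fls_nth_sum sum_distrib_left mult.left_commute)
qed

lemma multiplier_curve_cong:
  assumes "\<And>a. a \<in> {- int (field_degree F) - 1 .. - 1} \<Longrightarrow> lam a = mu a"
  shows "multiplier_curve F \<beta> lam = multiplier_curve F \<beta> mu"
proof -
  have "laurent_sum {- int (field_degree F) - 1 .. - 1} lam =
      laurent_sum {- int (field_degree F) - 1 .. - 1} mu"
    unfolding laurent_sum_def by (intro sum.cong) (simp_all add: assms)
  then show ?thesis
    by (simp add: multiplier_curve_def)
qed

lemma zero_residue_sum: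
  assumes "finite K" "\<And>k. k \<in> K \<Longrightarrow> zero_residue n f (lam k)"
  shows "zero_residue n f (\<lambda>a. \<Sum>k\<in>K. c k * lam k a)"
proof -
  have "(\<Sum>b\<le>n. (\<Sum>k\<in>K. c k * lam k (- 1 - int b)) *s f b) =
      (\<Sum>k\<in>K. c k *s (\<Sum>b\<le>n. lam k (- 1 - int b) *s f b))"
    by (simp add: vec.scale_sum_left vec.scale_sum_right sum.swap[of _ "{..n}"])
  with assms(2) show ?thesis
    by (simp add: zero_residue_def)
qed

lemma zero_residue_diff:
  "zero_residue n f lam \<Longrightarrow> zero_residue n f mu \<Longrightarrow> zero_residue n f (\<lambda>a. lam a - mu a)"
  by (simp add: zero_residue_def vec.scale_left_diff_distrib sum_subtractf)

text \<open>A vanishing integral kills every coefficient of the product except the one at -1, which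
  the residue equation kills. The product is then 0 in an integral domain, and its field factor is
  not.\<close>

lemma multiplier_curve_eq_0D:
  assumes n: "n = field_degree F" and res: "zero_residue n (field_coeff F \<beta>) lam"
    and nz: "field_coeff F \<beta> j \<noteq> 0" "j \<le> n"
    and eq: "multiplier_curve F \<beta> lam = 0" and a: "a \<in> {- int n - 1 .. - 1}"
  shows "lam a = 0"
proof -
  let ?L = "laurent_sum {- int n - 1 .. - 1} lam"
  \<comment> \<open>One component suffices, since the same scalar multiplier acts on all
    three.\<close>
  obtain i where i: "field_coeff F \<beta> j $ i \<noteq> 0"
    using nz by (auto simp: vec_eq_iff)
  have "(?L * field_at F \<beta> $ i) $$ m = 0" for m
  proof (cases "m = - 1")
    case True
    have "(\<Sum>a\<in>{- int n - 1 .. - 1}. lam a * field_coeff F \<beta> (nat (- 1 - a)) $ i) =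
        (\<Sum>a\<in>{- int n - 1 .. - 1}. lam a *s field_coeff F \<beta> (nat (- 1 - a))) $ i"
      by simp
    also have "\<dots> = 0"
      using res unfolding zero_residue_altdef by simp
    finally show ?thesis
      \<comment> \<open>For \<open>a\<close> in the window, \<open>- 1 - a\<close> lies between 0
        and \<open>n\<close>, so the guard of \<open>field_at_nth\<close> always holds.\<close>
      unfolding True laurent_sum_mult_nth field_at_nth n[symmetric]
      by (subst (asm) sum.cong[OF refl]) (auto intro!: sum.cong elim!: trans[rotated])
  next
    case False
    have "fls_integral (?L * field_at F \<beta> $ i) $$ (m + 1) = 0"
      using eq by (simp add: vec_eq_iff multiplier_curve_def normalized_antiderivative_def n)
    moreover have "of_int (m + 1) \<noteq> (0 :: complex)"
      using False by (metis add.commute add_eq_0_iff of_int_eq_0_iff)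
    ultimately show ?thesis
      using False by (auto simp del: of_int_add split: if_splits)
  qed
  then have "?L * field_at F \<beta> $ i = 0"
    by (simp add: fls_eq_iff)
  moreover have "field_at F \<beta> $ i $$ int j \<noteq> 0"
    using i nz(2) by (simp add: field_at_nth n)
  then have "field_at F \<beta> $ i \<noteq> 0"
    by auto
  ultimately have "?L $$ a = 0"
    by simp
  with a show ?thesis
    by (simp add: laurent_sum_nth)
qed

section \<open>Linear algebra of the residue equation with three pivot vectors\<close>

locale residue_pivots =
  fixes n :: nat and f :: "nat \<Rightarrow> complex ^ 3" and i1 i2 i3 :: nat and D I :: "int set"
  assumes le: "i1 \<le> n" "i2 \<le> n" "i3 \<le> n"
    and dist: "distinct [f i1, f i2, f i3]" and indep: "vec.independent {f i1, f i2, f i3}"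
    and D: "D = {- 1 - int i1, - 1 - int i2, - 1 - int i3}"
    and I: "I = {- int n - 1 .. - 1} - D"
begin

lemma distinct_indices: "i1 \<noteq> i2" "i1 \<noteq> i3" "i2 \<noteq> i3"
  using dist by auto

lemma D_subset: "D \<subseteq> {- int n - 1 .. - 1}"
  using le by (auto simp: D)

lemma finite_D: "finite D" and finite_I: "finite I"
  by (simp_all add: D I)

lemma card_I: "int (card I) = int n - 2"
proof -
  have "card D = 3"
    using distinct_indices by (simp add: D)
  \<comment> \<open>This yields \<open>n \<ge> 2\<close>, so the subtraction of cardinalities does
    not truncate.\<close>
  moreover have "card D \<le> card {- int n - 1 .. - 1}"
    using D_subset by (intro card_mono) auto
  ultimately show ?thesis
    using D_subset finite_D by (simp add: I card_Diff_subset)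
qed

lemma zero_residue_split:
  "zero_residue n f lam \<longleftrightarrow>
     (\<Sum>a\<in>I. lam a *s f (nat (- 1 - a))) + (\<Sum>a\<in>D. lam a *s f (nat (- 1 - a))) = 0"
  unfolding zero_residue_altdef I using D_subset by (subst sum.subset_diff[of D]) auto

lemma sum_D:
  "(\<Sum>a\<in>D. lam a *s f (nat (- 1 - a))) =
     lam (- 1 - int i1) *s f i1 + lam (- 1 - int i2) *s f i2 + lam (- 1 - int i3) *s f i3"
  using distinct_indices by (simp add: D add.assoc)

lemma pivots_combination_eq_0D:
  assumes "x *s f i1 + y *s f i2 + z *s f i3 = 0"
  shows "x = 0 \<and> y = 0 \<and> z = 0"
proof -
  \<comment> \<open>Independence of a set speaks of coefficients attached to vectors; distinctness
    of the pivots lets \<open>u\<close> carry \<open>x\<close>, \<open>y\<close>,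
    \<open>z\<close>.\<close>
  define u where "u v = (if v = f i1 then x else if v = f i2 then y else z)" for v
  have "(\<Sum>v\<in>{f i1, f i2, f i3}. u v *s v) = 0"
    using assms dist by (auto simp: u_def add.assoc)
  then have "u v = 0" if "v \<in> {f i1, f i2, f i3}" for v
    using vec.independentD[OF indep _ subset_refl _ that] by simp
  from this[of "f i1"] this[of "f i2"] this[of "f i3"] show ?thesis
    using dist by (auto simp: u_def)
qed

text \<open>Three independent vectors exhaust a space of dimension 3.\<close>

lemma pivots_span: "\<exists>x y z. v = x *s f i1 + y *s f i2 + z *s f i3"
proof -
  have "card {f i1, f i2, f i3} = 3"
    using dist by simp
  moreover have "vec.dim (UNIV :: (complex ^ 3) set) = 3"
    by (simp only: vec_dim_card) simp
  ultimately have "UNIV \<subseteq> vec.span {f i1, f i2, f i3}"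
    using indep by (intro vec.card_ge_dim_independent) simp_all
  then obtain u where "v = (\<Sum>w\<in>{f i1, f i2, f i3}. u w *s w)"
    by (auto simp: vec.span_finite)
  also have "\<dots> = u (f i1) *s f i1 + u (f i2) *s f i2 + u (f i3) *s f i3"
    using dist by (simp add: add.assoc)
  finally show ?thesis
    by blast
qed

text \<open>Only the three terms over \<open>D\<close> survive in the residue equation, and they
  form a relation between the pivots.\<close>

lemma eq_0_if_zero_on_I:
  assumes "zero_residue n f lam" "\<And>a. a \<in> I \<Longrightarrow> lam a = 0" "a \<in> {- int n - 1 .. - 1}"
  shows "lam a = 0"
proof (cases "a \<in> I")
  case False
  then have "a \<in> D"
    using assms(3) by (simp add: I)
  moreover have "lam (- 1 - int i1) = 0 \<and> lam (- 1 - int i2) = 0 \<and> lam (- 1 - int i3) = 0"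
    using assms(1,2) by (intro pivots_combination_eq_0D) (simp add: zero_residue_split sum_D)
  ultimately show ?thesis
    by (auto simp: D)
qed (use assms in auto)

lemma eq_if_eq_on_I:
  assumes "zero_residue n f lam" "zero_residue n f mu" "\<And>a. a \<in> I \<Longrightarrow> lam a = mu a"
    "a \<in> {- int n - 1 .. - 1}"
  shows "lam a = mu a"
  using eq_0_if_zero_on_I[OF zero_residue_diff[OF assms(1,2)] _ assms(4)] assms(3) by simp

text \<open>The terms over \<open>I\<close> give a known vector; expanding its negative in the
  pivots yields the values on \<open>D\<close>.\<close>

lemma extension_exists:
  obtains lam where "\<And>a. a \<in> I \<Longrightarrow> lam a = c a" "\<And>a. a \<notin> {- int n - 1 .. - 1} \<Longrightarrow> lam a = 0"
    "zero_residue n f lam"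
proof -
  obtain x y z where xyz:
    "- (\<Sum>a\<in>I. c a *s f (nat (- 1 - a))) = x *s f i1 + y *s f i2 + z *s f i3"
    using pivots_span by blast
  define lam where "lam a = (if a \<in> I then c a else if a = - 1 - int i1 then x
    else if a = - 1 - int i2 then y else if a = - 1 - int i3 then z else 0)" for a
  have D': "- 1 - int i1 \<notin> I" "- 1 - int i2 \<notin> I" "- 1 - int i3 \<notin> I"
    by (auto simp: I D)
  have "(\<Sum>a\<in>I. lam a *s f (nat (- 1 - a))) = (\<Sum>a\<in>I. c a *s f (nat (- 1 - a)))"
    by (rule sum.cong) (auto simp: lam_def)
  moreover have "(\<Sum>a\<in>D. lam a *s f (nat (- 1 - a))) = x *s f i1 + y *s f i2 + z *s f i3"
    unfolding sum_D using distinct_indices D' by (simp add: lam_def)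
  ultimately have "zero_residue n f lam"
    by (simp add: zero_residue_split flip: xyz)
  moreover have "lam a = 0" if "a \<notin> {- int n - 1 .. - 1}" for a
  proof -
    have "a \<notin> I" "a \<notin> D"
      using that D_subset I by blast+
    then show ?thesis
      by (simp add: lam_def D)
  qed
  ultimately show ?thesis
    using that[of lam] by (simp add: lam_def)
qed

text \<open>Families are functions on all integers, so the value 0 outside the window has to be
  fixed for uniqueness.\<close>

lemma ex1_extension:
  assumes "k \<in> I"
  shows "\<exists>!lam :: int \<Rightarrow> complex. (\<forall>l. l \<notin> {- int n - 1 .. - 1} \<longrightarrow> lam l = 0) \<and>
    lam k = 1 \<and> (\<forall>l \<in> I - {k}. lam l = 0) \<and> zero_residue n f lam"
proof (rule ex_ex1I)
  obtain lam where "\<And>a. a \<in> I \<Longrightarrow> lam a = (if a = k then 1 else 0)"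
    "\<And>a. a \<notin> {- int n - 1 .. - 1} \<Longrightarrow> lam a = 0" "zero_residue n f lam"
    using extension_exists[of "\<lambda>a. if a = k then 1 else 0"] by metis
  then show "\<exists>lam. (\<forall>l. l \<notin> {- int n - 1 .. - 1} \<longrightarrow> lam l = 0) \<and>
      lam k = 1 \<and> (\<forall>l \<in> I - {k}. lam l = 0) \<and> zero_residue n f lam"
    using assms by (intro exI[of _ lam]) auto
next
  fix lam mu :: "int \<Rightarrow> complex"
  assume lam: "(\<forall>l. l \<notin> {- int n - 1 .. - 1} \<longrightarrow> lam l = 0) \<and>
      lam k = 1 \<and> (\<forall>l \<in> I - {k}. lam l = 0) \<and> zero_residue n f lam"
    and mu: "(\<forall>l. l \<notin> {- int n - 1 .. - 1} \<longrightarrow> mu l = 0) \<and>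
      mu k = 1 \<and> (\<forall>l \<in> I - {k}. mu l = 0) \<and> zero_residue n f mu"
  have "zero_residue n f lam" "zero_residue n f mu"
    using lam mu by blast+
  moreover have "lam a = mu a" if "a \<in> I" for a
    using lam mu that by (cases "a = k") auto
  ultimately have "lam a = mu a" if "a \<in> {- int n - 1 .. - 1}" for a
    using that by (rule eq_if_eq_on_I)
  moreover have "lam a = mu a" if "a \<notin> {- int n - 1 .. - 1}" for a
    using lam mu that by simp
  ultimately show "lam = mu"
    by (intro ext) blast
qed

text \<open>The families \<open>lam k\<close> restrict to Kronecker deltas on \<open>I\<close>, so a
  combination of them shows its coefficients as its values there. Injectivity of \<Phi> gives
  independence; determination by the values on \<open>I\<close> gives spanning.\<close>

lemma multiplier_curves_basis:
  assumes n: "n = field_degree F" and f: "f = field_coeff F \<beta>"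
    and lam: "\<And>k l. k \<in> I \<Longrightarrow> l \<in> I \<Longrightarrow> lam k l = (if l = k then 1 else 0)"
    and res: "\<And>k. k \<in> I \<Longrightarrow> zero_residue n f (lam k)"
    and r: "\<And>k. k \<in> I \<Longrightarrow> r k = multiplier_curve F \<beta> (lam k)"
  shows "inj_on r I \<and> curve.independent (r ` I) \<and> curve.span (r ` I) = nonregular_curves F \<beta>"
proof -
  define comb where "comb c = (\<lambda>a. \<Sum>k\<in>I. c k * lam k a)" for c
  have sum_r: "(\<Sum>k\<in>I. curve_scale (c k) (r k)) = multiplier_curve F \<beta> (comb c)" for c
    unfolding comb_def multiplier_curve_sum[OF finite_I] by (simp add: r)
  have comb_res: "zero_residue n f (comb c)" for c
    unfolding comb_def using finite_I res by (rule zero_residue_sum)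
  have comb_I: "comb c l = c l" if "l \<in> I" for c l
    using that finite_I by (simp add: comb_def lam if_distrib cong: if_cong)
  \<comment> \<open>Any pivot can serve as the nonzero field coefficient that injectivity of \<Phi>
    requires.\<close>
  have "f i1 \<noteq> 0"
    using pivots_combination_eq_0D[of 1 0 0] by auto
  then have zero: "mu a = 0"
    if "zero_residue n f mu" "multiplier_curve F \<beta> mu = 0" "a \<in> {- int n - 1 .. - 1}" for mu a
    using multiplier_curve_eq_0D[OF n, of \<beta> mu i1 a] that le f by simp
  have scalars: "c k = 0" if "(\<Sum>k\<in>I. curve_scale (c k) (r k)) = 0" "k \<in> I" for c k
  proof -
    have "comb c k = 0"
      using that(1)[unfolded sum_r] that(2) by (intro zero[OF comb_res]) (simp_all add: I)
    with that(2) show ?thesis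
      by (simp add: comb_I)
  qed
  have inj: "inj_on r I"
  proof (rule inj_onI, rule ccontr)
    fix k l assume *: "k \<in> I" "l \<in> I" "r k = r l" "k \<noteq> l"
    define c :: "int \<Rightarrow> complex" where "c a = (if a = k then 1 else if a = l then - 1 else 0)" for a
    have "(\<Sum>a\<in>I. curve_scale (c a) (r a)) = (\<Sum>a\<in>{k, l}. curve_scale (c a) (r a))"
      using * finite_I by (intro sum.mono_neutral_right) (auto simp: c_def)
    also have "\<dots> = 0"
      using * by (simp add: c_def)
    finally have "c k = 0"
      using * by (intro scalars)
    then show False
      by (simp add: c_def)
  qed
  have "curve.independent (r ` I)"
  proof (rule curve.independent_if_scalars_zero)
    fix u x assume "(\<Sum>x\<in>r ` I. curve_scale (u x) x) = 0" "x \<in> r ` I"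
    then show "u x = 0"
      using scalars[of "\<lambda>k. u (r k)"] by (auto simp: sum.reindex[OF inj])
  qed (simp add: finite_I)
  moreover have "curve.span (r ` I) = nonregular_curves F \<beta>"
  proof (intro equalityI subsetI)
    fix x assume "x \<in> curve.span (r ` I)"
    then obtain u where "x = (\<Sum>x\<in>r ` I. curve_scale (u x) x)"
      by (auto simp: curve.span_finite finite_I)
    then have "x = multiplier_curve F \<beta> (comb (\<lambda>k. u (r k)))"
      by (simp add: sum.reindex[OF inj] sum_r)
    then show "x \<in> nonregular_curves F \<beta>"
      unfolding nonregular_curves_altdef using comb_res n f by blast
  next
    fix x assume "x \<in> nonregular_curves F \<beta>"
    then obtain mu where mu: "x = multiplier_curve F \<beta> mu" "zero_residue n f mu"
      unfolding nonregular_curves_altdef n f by blast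
    \<comment> \<open>Both families solve the residue equation and agree on \<open>I\<close>, so the
      coordinates of \<open>x\<close> are the values of \<open>mu\<close> on
      \<open>I\<close>.\<close>
    have "mu a = comb mu a" if "a \<in> {- int n - 1 .. - 1}" for a
      using mu(2) comb_res _ that by (rule eq_if_eq_on_I) (simp add: comb_I)
    then have "x = (\<Sum>k\<in>I. curve_scale (mu k) (r k))"
      unfolding mu(1) sum_r by (intro multiplier_curve_cong) (simp add: n)
    then show "x \<in> curve.span (r ` I)"
      by (simp add: curve.span_sum curve.span_scale curve.span_base)
  qed
  ultimately show ?thesis
    using inj by blast
qed

end

theorem mainTheorem3:
  fixes F :: "real poly ^ 3" and \<beta> :: complex and n :: nat
    and f :: "nat \<Rightarrow> complex ^ 3" and i1 i2 i3 :: nat and D I :: "int set"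
  assumes degree: "n = field_degree F"
    and "truly_spatial F"
    and "no_common_factor F"
    and f: "f = field_coeff F \<beta>"
    and "i1 \<in> {0..n}" "i2 \<in> {0..n}" "i3 \<in> {0..n}"
    and "distinct [f i1, f i2, f i3]" "vec.independent {f i1, f i2, f i3}"
    and D: "D = {- 1 - int i1, - 1 - int i2, - 1 - int i3}"
    and I: "I = {- int n - 1 .. - 1} - D"
  shows "int (card I) = int n - 2 \<and>
        (\<forall>k\<in>I. \<exists>!lam :: int \<Rightarrow> complex.
           (\<forall>l. l \<notin> {- int n - 1 .. - 1} \<longrightarrow> lam l = 0) \<and>
           lam k = 1 \<and> (\<forall>l \<in> I - {k}. lam l = 0) \<and> zero_residue n f lam) \<and>
        (\<forall>(lam :: int \<Rightarrow> int \<Rightarrow> complex) (r :: int \<Rightarrow> complex fls ^ 3).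
           (\<forall>k\<in>I. lam k k = 1 \<and> (\<forall>l \<in> I - {k}. lam k l = 0) \<and> zero_residue n f (lam k) \<and>
                   r k = laurent_curve {- int n .. int n} (curve_coeff n f (lam k)))
           \<longrightarrow> inj_on r I \<and> curve.independent (r ` I) \<and> curve.span (r ` I) = nonregular_curves F \<beta>)"
proof -
  interpret residue_pivots n f i1 i2 i3 D I
    using assms by unfold_locales auto
  show ?thesis
  proof (intro conjI ballI allI impI card_I ex1_extension)
    fix lam :: "int \<Rightarrow> int \<Rightarrow> complex" and r :: "int \<Rightarrow> complex fls ^ 3"
    assume *: "\<forall>k\<in>I. lam k k = 1 \<and> (\<forall>l \<in> I - {k}. lam k l = 0) \<and> zero_residue n f (lam k) \<and>
      r k = laurent_curve {- int n .. int n} (curve_coeff n f (lam k))"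
    \<comment> \<open>The curves given by explicit coefficients are images under \<Phi>, so the
      basis criterion applies to them.\<close>
    have basis: "inj_on r I \<and> curve.independent (r ` I) \<and> curve.span (r ` I) = nonregular_curves F \<beta>"
      using * by (intro multiplier_curves_basis[OF degree f, of lam])
        (auto simp: f laurent_curve_eq_multiplier_curve[OF degree])
    from basis show "inj_on r I" by simp
    from basis show "curve.independent (r ` I)" by simp
    from basis show "curve.span (r ` I) = nonregular_curves F \<beta>" by simp
  qed
qed

end
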